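(* Let $(X,S)$ be a non-degenerate, involutive and braided "set-theoretical" solution of the quantum Yang-Baxter equation, where $X$ is a finite set. Let $G$ be the structure group of $(X,S)$ and let $M$ be the monoid with the same presentation. Then $(X,S)$ is indecomposable if and only if $G$ is Garside $\Delta$-pure, that is, if and only if the monoid $M$ is a $\Delta$-pure Garside monoid.
   Context: Solutions. Let $X$ be a non-empty set and $S:X\times X\to X\times X$ a bijection, written $S(x,y)=(g_x(y),f_y(x))$. $(X,S)$ is non-degenerate if all the maps $f_x,g_x:X\to X$ are bijective; involutive if $S^2=\mathrm{id}$; braided if $S^{12}S^{23}S^{12}=S^{23}S^{12}S^{23}$ on $X^3$, where $S^{12}=S\times \mathrm{id}_X$, $S^{23}=\mathrm{id}_X\times S$. The structure group $G$ (resp. the monoid $M$ with the same presentation) is the group (resp. monoid) generated by $X$ with defining relations $xy=tz$ whenever $S(x,y)=(t,z)$. Indecomposability. A subset $Y\subseteq X$ is invariant if $S(Y\times Y)\subseteq Y\times Y$; an invariant subset $Y$ is non-degenerate if $(Y,S|_{Y\times Y})$ is non-degenerate, involutive and braided. $(X,S)$ is decomposable if $X$ is the union of two nonempty disjoint non-degenerate invariant subsets, and indecomposable otherwise. Garside monoids. $x$ is a left (resp. right) divisor of $z$ if $z=xt$ (resp. $z=tx$) for some $t$. A right lcm $x\vee y$ of $x,y$ is an element having $x,y$ as left divisors that is a left divisor of every element having $x,y$ as left divisors; a left gcd is a common left divisor that every common left divisor left-divides; left lcm and right gcd are defined symmetrically. An atom is an $x\neq1$ such that $x=yz$ implies $y=1$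 or $z=1$. A monoid is atomic if it is generated by its atoms and each element has a finite supremum of lengths of decompositions into atoms. It is Gaussian if it is atomic, left and right cancellative, and any two elements have left and right gcds and lcms. A Garside element is an element $\Delta$ whose left divisors coincide with its right divisors, are finite in number, and generate the monoid. A Garside monoid is a Gaussian monoid containing a Garside element. $\Delta$-purity. In a Garside monoid $M$, the right complement $x\setminus y$ is the element with $x\vee y=x(x\setminus y)$. For $a\in M$ put $\Delta_a=\bigvee\{b\setminus a: b\in M\}$ (right lcm). The Garside monoid $M$ is $\Delta$-pure if $\Delta_x=\Delta_y$ for all atoms $x,y$ of $M$. *)

theory Defs
  imports "HOL-Algebra.Divisibility"
begin

section \<open>Set-theoretical solutions of the quantum Yang-Baxter equation\<close>

text \<open>Solutions live on a carrier set \<open>X\<close>; the values of \<open>S\<close> outside \<open>X \<times> X\<close> are irrelevant, so the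
  restriction of \<open>S\<close> to \<open>Y \<times> Y\<close> is again represented by \<open>S\<close>, with carrier \<open>Y\<close>.
  The component maps are given by \<open>S (x, y) = (g_x(y), f_y(x))\<close>.\<close>

definition gmap :: "('a \<times> 'a \<Rightarrow> 'a \<times> 'a) \<Rightarrow> 'a \<Rightarrow> 'a \<Rightarrow> 'a" where
  "gmap S x y = fst (S (x, y))"

definition fmap :: "('a \<times> 'a \<Rightarrow> 'a \<times> 'a) \<Rightarrow> 'a \<Rightarrow> 'a \<Rightarrow> 'a" where
  "fmap S y x = snd (S (x, y))"

definition set_solution :: "'a set \<Rightarrow> ('a \<times> 'a \<Rightarrow> 'a \<times> 'a) \<Rightarrow> bool" where
  "set_solution X S \<longleftrightarrow> X \<noteq> {} \<and> bij_betw S (X \<times> X) (X \<times> X)"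

definition nondegenerate :: "'a set \<Rightarrow> ('a \<times> 'a \<Rightarrow> 'a \<times> 'a) \<Rightarrow> bool" where
  "nondegenerate X S \<longleftrightarrow> (\<forall>x\<in>X. bij_betw (fmap S x) X X \<and> bij_betw (gmap S x) X X)"

definition involutive :: "'a set \<Rightarrow> ('a \<times> 'a \<Rightarrow> 'a \<times> 'a) \<Rightarrow> bool" where
  "involutive X S \<longleftrightarrow> (\<forall>p\<in>X \<times> X. S (S p) = p)"

definition S12 :: "('a \<times> 'a \<Rightarrow> 'a \<times> 'a) \<Rightarrow> 'a \<times> 'a \<times> 'a \<Rightarrow> 'a \<times> 'a \<times> 'a" where
  "S12 S = (\<lambda>(x, y, z). case S (x, y) of (t, u) \<Rightarrow> (t, u, z))"

definition S23 :: "('a \<times> 'a \<Rightarrow> 'a \<times> 'a) \<Rightarrow> 'a \<times> 'a \<times> 'a \<Rightarrow> 'a \<times> 'a \<times> 'a" where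
  "S23 S = (\<lambda>(x, y, z). (x, S (y, z)))"

definition braided :: "'a set \<Rightarrow> ('a \<times> 'a \<Rightarrow> 'a \<times> 'a) \<Rightarrow> bool" where
  "braided X S \<longleftrightarrow>
     (\<forall>p\<in>X \<times> X \<times> X. S12 S (S23 S (S12 S p)) = S23 S (S12 S (S23 S p)))"

definition invariant_subset :: "'a set \<Rightarrow> ('a \<times> 'a \<Rightarrow> 'a \<times> 'a) \<Rightarrow> 'a set \<Rightarrow> bool" where
  "invariant_subset X S Y \<longleftrightarrow> Y \<subseteq> X \<and> S ` (Y \<times> Y) \<subseteq> Y \<times> Y"

definition nondegenerate_invariant_subset ::
    "'a set \<Rightarrow> ('a \<times> 'a \<Rightarrow> 'a \<times> 'a) \<Rightarrow> 'a set \<Rightarrow> bool" where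
  "nondegenerate_invariant_subset X S Y \<longleftrightarrow>
     invariant_subset X S Y \<and> nondegenerate Y S \<and> involutive Y S \<and> braided Y S"

definition decomposable :: "'a set \<Rightarrow> ('a \<times> 'a \<Rightarrow> 'a \<times> 'a) \<Rightarrow> bool" where
  "decomposable X S \<longleftrightarrow>
     (\<exists>Y Z. Y \<noteq> {} \<and> Z \<noteq> {} \<and> Y \<inter> Z = {} \<and> X = Y \<union> Z \<and>
        nondegenerate_invariant_subset X S Y \<and> nondegenerate_invariant_subset X S Z)"

definition indecomposable :: "'a set \<Rightarrow> ('a \<times> 'a \<Rightarrow> 'a \<times> 'a) \<Rightarrow> bool" where
  "indecomposable X S \<longleftrightarrow> \<not> decomposable X S"

section \<open>The structure monoid\<close>

text \<open>The least congruence on the free monoid \<open>lists X\<close> containing the relations \<open>R\<close>.\<close>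

inductive_set word_cong :: "'a set \<Rightarrow> ('a list \<times> 'a list) set \<Rightarrow> ('a list \<times> 'a list) set"
  for X R where
  word_cong_refl: "u \<in> lists X \<Longrightarrow> (u, u) \<in> word_cong X R"
| word_cong_sym: "(u, v) \<in> word_cong X R \<Longrightarrow> (v, u) \<in> word_cong X R"
| word_cong_trans:
    "(u, v) \<in> word_cong X R \<Longrightarrow> (v, w) \<in> word_cong X R \<Longrightarrow> (u, w) \<in> word_cong X R"
| word_cong_rel:
    "(u, v) \<in> R \<Longrightarrow> u \<in> lists X \<Longrightarrow> v \<in> lists X \<Longrightarrow> a \<in> lists X \<Longrightarrow> b \<in> lists X \<Longrightarrow>
     (a @ u @ b, a @ v @ b) \<in> word_cong X R"

definition presented_monoid :: "'a set \<Rightarrow> ('a list \<times> 'a list) set \<Rightarrow> 'a list set monoid" where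
  "presented_monoid X R =
     \<lparr>carrier = lists X // word_cong X R,
      mult = (\<lambda>A B. \<Union>u\<in>A. \<Union>v\<in>B. word_cong X R `` {u @ v}),
      one = word_cong X R `` {[]}\<rparr>"

definition structure_relations ::
    "'a set \<Rightarrow> ('a \<times> 'a \<Rightarrow> 'a \<times> 'a) \<Rightarrow> ('a list \<times> 'a list) set" where
  "structure_relations X S = {([x, y], [t, z]) | x y t z. x \<in> X \<and> y \<in> X \<and> S (x, y) = (t, z)}"

definition structure_monoid :: "'a set \<Rightarrow> ('a \<times> 'a \<Rightarrow> 'a \<times> 'a) \<Rightarrow> 'a list set monoid" where
  "structure_monoid X S = presented_monoid X (structure_relations X S)"

section \<open>Garside monoids\<close>

text \<open>In a possibly non-commutative monoid, the library notions \<open>a divides b\<close>, \<open>x gcdof a b\<close>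
  and \<open>x lcmof a b\<close> say that \<open>a\<close> is a left divisor of \<open>b\<close>, that \<open>x\<close> is a left gcd
  (a greatest common left divisor) and that \<open>x\<close> is a right lcm (a least common right multiple).
  Taken in the opposite monoid, they give right divisors, right gcds and left lcms.\<close>

definition op_monoid :: "'m monoid \<Rightarrow> 'm monoid" where
  "op_monoid M = \<lparr>carrier = carrier M, mult = (\<lambda>x y. y \<otimes>\<^bsub>M\<^esub> x), one = \<one>\<^bsub>M\<^esub>\<rparr>"

definition list_mult :: "'m monoid \<Rightarrow> 'm list \<Rightarrow> 'm" where
  "list_mult M ws = foldr (\<otimes>\<^bsub>M\<^esub>) ws \<one>\<^bsub>M\<^esub>"

definition generates_monoid :: "'m monoid \<Rightarrow> 'm set \<Rightarrow> bool" where
  "generates_monoid M A \<longleftrightarrow> A \<subseteq> carrier M \<and> carrier M \<subseteq> list_mult M ` lists A"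

definition atoms :: "'m monoid \<Rightarrow> 'm set" where
  "atoms M = {x \<in> carrier M. x \<noteq> \<one>\<^bsub>M\<^esub> \<and>
     (\<forall>y\<in>carrier M. \<forall>z\<in>carrier M. x = y \<otimes>\<^bsub>M\<^esub> z \<longrightarrow> y = \<one>\<^bsub>M\<^esub> \<or> z = \<one>\<^bsub>M\<^esub>)}"

definition atomic :: "'m monoid \<Rightarrow> bool" where
  "atomic M \<longleftrightarrow> generates_monoid M (atoms M) \<and>
     (\<forall>x\<in>carrier M. bdd_above {length ws | ws. ws \<in> lists (atoms M) \<and> list_mult M ws = x})"

definition gaussian_monoid :: "'m monoid \<Rightarrow> bool" where
  "gaussian_monoid M \<longleftrightarrow> monoid_cancel M \<and> atomic M \<and>
     (\<forall>x\<in>carrier M. \<forall>y\<in>carrier M.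
        (\<exists>z\<in>carrier M. z gcdof\<^bsub>M\<^esub> x y) \<and>
        (\<exists>z\<in>carrier M. z lcmof\<^bsub>M\<^esub> x y) \<and>
        (\<exists>z\<in>carrier M. z gcdof\<^bsub>op_monoid M\<^esub> x y) \<and>
        (\<exists>z\<in>carrier M. z lcmof\<^bsub>op_monoid M\<^esub> x y))"

definition left_divisors :: "'m monoid \<Rightarrow> 'm \<Rightarrow> 'm set" where
  "left_divisors M z = {x \<in> carrier M. x divides\<^bsub>M\<^esub> z}"

definition right_divisors :: "'m monoid \<Rightarrow> 'm \<Rightarrow> 'm set" where
  "right_divisors M z = {x \<in> carrier M. x divides\<^bsub>op_monoid M\<^esub> z}"

definition garside_element :: "'m monoid \<Rightarrow> 'm \<Rightarrow> bool" where
  "garside_element M d \<longleftrightarrow> d \<in> carrier M \<and>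
     left_divisors M d = right_divisors M d \<and> finite (left_divisors M d) \<and>
     generates_monoid M (left_divisors M d)"

definition garside_monoid :: "'m monoid \<Rightarrow> bool" where
  "garside_monoid M \<longleftrightarrow> gaussian_monoid M \<and> (\<exists>d. garside_element M d)"

section \<open>Delta-purity\<close>

text \<open>\<open>is_right_complement M x y c\<close> expresses that \<open>c\<close> is the complement \<open>x \ y\<close>, and
  \<open>is_Delta M a d\<close> that the right lcm \<open>\<Delta>_a\<close> of all complements \<open>b \ a\<close> exists and equals \<open>d\<close>.
  In a Gaussian monoid both are unique, by cancellation and since \<open>\<one>\<close> is the only unit.\<close>

definition is_right_complement :: "'m monoid \<Rightarrow> 'm \<Rightarrow> 'm \<Rightarrow> 'm \<Rightarrow> bool" where
  "is_right_complement M x y c \<longleftrightarrow> c \<in> carrier M \<and> (x \<otimes>\<^bsub>M\<^esub> c) lcmof\<^bsub>M\<^esub> x y"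

definition is_right_lcm_set :: "'m monoid \<Rightarrow> 'm set \<Rightarrow> 'm \<Rightarrow> bool" where
  "is_right_lcm_set M A d \<longleftrightarrow> d \<in> carrier M \<and> (\<forall>a\<in>A. a divides\<^bsub>M\<^esub> d) \<and>
     (\<forall>e\<in>carrier M. (\<forall>a\<in>A. a divides\<^bsub>M\<^esub> e) \<longrightarrow> d divides\<^bsub>M\<^esub> e)"

definition is_Delta :: "'m monoid \<Rightarrow> 'm \<Rightarrow> 'm \<Rightarrow> bool" where
  "is_Delta M a d \<longleftrightarrow> is_right_lcm_set M {c. \<exists>b\<in>carrier M. is_right_complement M b a c} d"

definition Delta_pure :: "'m monoid \<Rightarrow> bool" where
  "Delta_pure M \<longleftrightarrow> (\<forall>x\<in>atoms M. \<forall>y\<in>atoms M. \<exists>d. is_Delta M x d \<and> is_Delta M y d)"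

definition Delta_pure_garside_monoid :: "'m monoid \<Rightarrow> bool" where
  "Delta_pure_garside_monoid M \<longleftrightarrow> garside_monoid M \<and> Delta_pure M"

end

theory Submission
  imports Defs "HOL-Library.Multiset"
begin

text \<open>The structure monoid is a twisted copy of a free commutative monoid. Reading a word
\<open>x\<^sub>1 x\<^sub>2 x\<^sub>3 \<dots>\<close> as the multiset \<open>{x\<^sub>1, g\<^bsub>x\<^sub>1\<^esub> x\<^sub>2, g\<^bsub>x\<^sub>1\<^esub> g\<^bsub>x\<^sub>2\<^esub> x\<^sub>3, \<dots>}\<close> identifies the monoid with the
set of finite multisets over \<open>X\<close>, and the product becomes \<open>p (x y) = p x + \<phi>\<^sub>x (p y)\<close> with a
permutation \<open>\<phi>\<^sub>x\<close> of \<open>X\<close> (\<open>content_sound\<close>, \<open>content_complete\<close>, \<open>content_image\<close>). Since \<open>\<phi>\<^sub>x\<close>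
permutes \<open>X\<close>, left divisibility is inclusion of multisets, so left gcds and right lcms are
intersections and unions, and left cancellation is clear. The same applied to the opposite
solution gives different coordinates for the opposite monoid, hence right divisibility. The multiset
containing each letter once is a Garside element: square-freeness shows that its right divisors are left
divisors, and cancellation shows that there are equally many of both. So the monoid is Garside for
every solution.

In coordinates, \<open>b \ a\<close> for an atom \<open>a\<close> is trivial if \<open>a\<close> divides \<open>b\<close> and is the atom
\<open>\<phi>\<^sub>b\<^sup>-\<^sup>1 a\<close> otherwise. So \<open>\<Delta>\<^sub>a\<close> is the square-free multiset on the set \<open>reach a\<close> of all
\<open>\<phi>\<^sub>b\<^sup>-\<^sup>1 a\<close> with \<open>b\<close> avoiding \<open>a\<close>, and purity says that \<open>reach a = X\<close> for all \<open>a\<close>. What is left is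
to compare this condition with indecomposability. A decomposition is preserved by all \<open>g\<^sub>x\<close>, hence
confines \<open>reach a\<close>. Conversely, \<open>reach a\<close> is preserved by all \<open>g\<^sub>x\<close>, so that, when it is proper,
it and its complement decompose \<open>X\<close>. The point (\<open>g_image_reach\<close>) is that the side condition on \<open>b\<close>
makes \<open>reach a\<close> closed only under the steps \<open>c \<mapsto> g\<^sub>x\<^sup>-\<^sup>1 c\<close> with \<open>x \<noteq> c\<close>; the remaining steps
\<open>T c = g\<^sub>c\<^sup>-\<^sup>1 c\<close> are controlled by the injectivity of \<open>T\<close>.\<close>

section \<open>Monoids coordinatised by multisets\<close>

lemma image_mset_inv_into_cancel:
  assumes "inj_on f X" "set_mset m \<subseteq> X"
  shows "image_mset (inv_into X f) (image_mset f m) = m"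
proof -
  have "image_mset (inv_into X f \<circ> f) m = image_mset id m"
    using assms by (intro image_mset_cong) auto
  then show ?thesis by (simp add: multiset.map_comp)
qed

lemma image_mset_f_inv_into:
  assumes "set_mset m \<subseteq> f ` X"
  shows "image_mset f (image_mset (inv_into X f) m) = m"
proof -
  have "image_mset (f \<circ> inv_into X f) m = image_mset id m"
    using assms by (intro image_mset_cong) (auto simp: f_inv_into_f subset_iff)
  then show ?thesis by (simp add: multiset.map_comp)
qed

text \<open>The product is addition of multisets, except that the second factor is first permuted by the
first one: \<open>p\<close> is a bijective 1-cocycle with values in the free commutative monoid over \<open>X\<close>.\<close>

locale multiset_coordinates = monoid M for M :: "'m monoid" (structure) +
  fixes X :: "'b set" and p :: "'m \<Rightarrow> 'b multiset" and \<phi> :: "'m \<Rightarrow> 'b \<Rightarrow> 'b"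
  assumes finite_X: "finite X"
    and p_bij: "bij_betw p (carrier M) {m. set_mset m \<subseteq> X}"
    and p_mult: "\<lbrakk>x \<in> carrier M; y \<in> carrier M\<rbrakk> \<Longrightarrow> p (x \<otimes> y) = p x + image_mset (\<phi> x) (p y)"
    and \<phi>_bij: "x \<in> carrier M \<Longrightarrow> bij_betw (\<phi> x) X X"
begin

lemma p_set: "x \<in> carrier M \<Longrightarrow> set_mset (p x) \<subseteq> X"
  using p_bij by (auto dest: bij_betwE)

lemma p_eq_iff: "\<lbrakk>x \<in> carrier M; y \<in> carrier M\<rbrakk> \<Longrightarrow> p x = p y \<longleftrightarrow> x = y"
  using p_bij by (auto simp: bij_betw_def inj_on_def)

lemma p_surj:
  assumes "set_mset m \<subseteq> X"
  obtains x where "x \<in> carrier M" "p x = m"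
proof -
  have "m \<in> p ` carrier M" using p_bij assms by (simp add: bij_betw_def)
  then show thesis using that by blast
qed

lemma size_mult: "\<lbrakk>x \<in> carrier M; y \<in> carrier M\<rbrakk> \<Longrightarrow> size (p (x \<otimes> y)) = size (p x) + size (p y)"
  by (simp add: p_mult)

lemma p_one: "p \<one> = {#}"
  using size_mult[of \<one> \<one>] by simp

lemma p_empty_iff: "x \<in> carrier M \<Longrightarrow> p x = {#} \<longleftrightarrow> x = \<one>"
  using p_eq_iff[of x \<one>] p_one by simp

lemma image_\<phi>_inv:
  assumes "x \<in> carrier M" "set_mset m \<subseteq> X"
  shows "image_mset (inv_into X (\<phi> x)) (image_mset (\<phi> x) m) = m"
  using image_mset_inv_into_cancel bij_betw_imp_inj_on[OF \<phi>_bij] assms by metis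

lemma image_\<phi>_surj:
  assumes "x \<in> carrier M" "set_mset m \<subseteq> X"
  obtains y where "y \<in> carrier M" "image_mset (\<phi> x) (p y) = m"
proof -
  have im: "\<phi> x ` X = X" using \<phi>_bij[OF assms(1)] by (simp add: bij_betw_def)
  let ?m = "image_mset (inv_into X (\<phi> x)) m"
  have "set_mset ?m \<subseteq> X"
    using assms(2) im by (auto intro!: inv_into_into)
  then obtain y where y: "y \<in> carrier M" "p y = ?m" by (rule p_surj)
  have "image_mset (\<phi> x) ?m = m" by (rule image_mset_f_inv_into) (simp add: im assms(2))
  then show thesis using that y by auto
qed

lemma left_cancel:
  assumes "x \<in> carrier M" "y \<in> carrier M" "z \<in> carrier M" "z \<otimes> x = z \<otimes> y"
  shows "x = y"
proof -
  have "image_mset (\<phi> z) (p x) = image_mset (\<phi> z) (p y)"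
    using p_mult[of z x] p_mult[of z y] assms by simp
  then have "p x = p y"
    using image_\<phi>_inv[of z "p x"] image_\<phi>_inv[of z "p y"] p_set assms by metis
  then show ?thesis using p_eq_iff assms by blast
qed

text \<open>The cofactor exists because every multiset, in particular \<open>p y - p x\<close>, is of the form
\<open>\<phi>\<^sub>x (p z)\<close>. This turns all questions on left divisors into questions on the lattice of multisets.\<close>

lemma divides_iff:
  assumes "x \<in> carrier M" "y \<in> carrier M"
  shows "x divides y \<longleftrightarrow> p x \<subseteq># p y"
proof
  assume "x divides y"
  then show "p x \<subseteq># p y" using p_mult assms by (auto simp: factor_def)
next
  assume le: "p x \<subseteq># p y"
  have "set_mset (p y - p x) \<subseteq> X" using p_set[OF assms(2)] by (meson in_diffD subset_iff)
  then obtain z where z: "z \<in> carrier M" "image_mset (\<phi> x) (p z) = p y - p x"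
    using image_\<phi>_surj assms(1) by blast
  then have "p (x \<otimes> z) = p y" using p_mult[OF assms(1) z(1)] le by simp
  then have "y = x \<otimes> z" using p_eq_iff[of y "x \<otimes> z"] assms z(1) by simp
  then show "x divides y" using z(1) by (auto simp: factor_def)
qed

lemma ex_gcd:
  assumes "x \<in> carrier M" "y \<in> carrier M"
  shows "\<exists>z\<in>carrier M. z gcdof x y"
proof -
  have "set_mset (p x \<inter># p y) \<subseteq> X" using p_set assms by auto
  then obtain z where z: "z \<in> carrier M" "p z = p x \<inter># p y" by (rule p_surj)
  then have "z gcdof x y" using assms by (auto simp: isgcd_def divides_iff)
  then show ?thesis using z(1) by blast
qed

lemma lcm_iff:
  assumes "x \<in> carrier M" "y \<in> carrier M" "z \<in> carrier M"
  shows "z lcmof x y \<longleftrightarrow> p z = p x \<union># p y"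
proof
  assume z: "z lcmof x y"
  have "set_mset (p x \<union># p y) \<subseteq> X" using p_set assms by auto
  then obtain w where w: "w \<in> carrier M" "p w = p x \<union># p y" by (rule p_surj)
  then have "p z \<subseteq># p w" using z assms by (auto simp: islcm_def divides_iff)
  moreover have "p x \<union># p y \<subseteq># p z" using z assms by (auto simp: islcm_def divides_iff)
  ultimately show "p z = p x \<union># p y" using w by (metis subset_mset.antisym)
qed (use assms in \<open>auto simp: islcm_def divides_iff\<close>)

lemma ex_lcm:
  assumes "x \<in> carrier M" "y \<in> carrier M"
  shows "\<exists>z\<in>carrier M. z lcmof x y"
proof -
  have "set_mset (p x \<union># p y) \<subseteq> X" using p_set assms by auto
  then obtain z where "z \<in> carrier M" "p z = p x \<union># p y" by (rule p_surj)
  then show ?thesis using assms by (auto simp: lcm_iff)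
qed

text \<open>Any letter of \<open>p x\<close> gives a left divisor of \<open>x\<close>, and sizes add up under products.\<close>

lemma atoms_eq: "atoms M = {x \<in> carrier M. size (p x) = 1}"
proof (intro equalityI subsetI)
  fix x assume x: "x \<in> atoms M"
  then have xc: "x \<in> carrier M" and x1: "x \<noteq> \<one>" by (auto simp: atoms_def)
  obtain a m where am: "p x = add_mset a m"
    using x1 p_empty_iff[OF xc] by (cases "p x") auto
  then have "set_mset {#a#} \<subseteq> X" using p_set[OF xc] by auto
  then obtain y where y: "y \<in> carrier M" "p y = {#a#}" by (rule p_surj)
  have "y divides x" using divides_iff y xc am by simp
  then obtain z where z: "z \<in> carrier M" "x = y \<otimes> z" by (auto simp: factor_def)
  have "y = \<one> \<or> z = \<one>" using x y z by (auto simp: atoms_def)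
  moreover have "y \<noteq> \<one>" using y p_one by auto
  ultimately show "x \<in> {x \<in> carrier M. size (p x) = 1}" using y z by auto
next
  fix x assume x: "x \<in> {x \<in> carrier M. size (p x) = 1}"
  moreover have "y = \<one> \<or> z = \<one>" if "y \<in> carrier M" "z \<in> carrier M" "x = y \<otimes> z" for y z
  proof -
    have "size (p y) + size (p z) = 1" using x that size_mult by simp
    then have "p y = {#} \<or> p z = {#}" by (auto simp: add_is_1)
    then show ?thesis using p_empty_iff that by blast
  qed
  ultimately show "x \<in> atoms M" using p_one by (auto simp: atoms_def)
qed

lemma list_mult_atoms:
  assumes "ws \<in> lists (atoms M)"
  shows "list_mult M ws \<in> carrier M \<and> size (p (list_mult M ws)) = length ws"
  using assms by induction (auto simp: list_mult_def p_one size_mult atoms_eq)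

lemma generated_by_atoms: "generates_monoid M (atoms M)"
proof -
  have "x \<in> list_mult M ` lists (atoms M)" if "x \<in> carrier M" "size (p x) = n" for x n
    using that
  proof (induction n arbitrary: x)
    case 0
    then have "x = list_mult M []" using p_empty_iff by (simp add: list_mult_def)
    then show ?case by (intro image_eqI) auto
  next
    case (Suc n)
    then obtain a m where am: "p x = add_mset a m" by (metis size_eq_Suc_imp_eq_union)
    then have "set_mset {#a#} \<subseteq> X" using p_set[OF Suc.prems(1)] by auto
    then obtain y where y: "y \<in> carrier M" "p y = {#a#}" by (rule p_surj)
    have "y divides x" using divides_iff y Suc.prems am by simp
    then obtain z where z: "z \<in> carrier M" "x = y \<otimes> z" by (auto simp: factor_def)
    have "size (p z) = n" using size_mult[OF y(1) z(1)] y z Suc.prems by simp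
    then obtain ws where "ws \<in> lists (atoms M)" "z = list_mult M ws" using Suc.IH z by blast
    moreover have "y \<in> atoms M" using y by (simp add: atoms_eq)
    ultimately have "x = list_mult M (y # ws)" "y # ws \<in> lists (atoms M)"
      using z by (auto simp: list_mult_def)
    then show ?case by blast
  qed
  then show ?thesis by (auto simp: generates_monoid_def atoms_eq)
qed

lemma atomic: "atomic M"
proof -
  have "bdd_above {length ws |ws. ws \<in> lists (atoms M) \<and> list_mult M ws = x}" for x
    by (rule bdd_aboveI[where M = "size (p x)"]) (auto dest!: list_mult_atoms)
  then show ?thesis using generated_by_atoms by (auto simp: atomic_def)
qed

text \<open>The right lcm of all atoms, which will be the Garside element.\<close>

definition \<delta> :: 'm where "\<delta> = (THE d. d \<in> carrier M \<and> p d = mset_set X)"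

lemma \<delta>: "\<delta> \<in> carrier M" "p \<delta> = mset_set X"
proof -
  obtain d where d: "d \<in> carrier M" "p d = mset_set X"
    using p_surj[of "mset_set X"] finite_X by auto
  then have "\<delta> = d" unfolding \<delta>_def by (intro the_equality) (auto simp: p_eq_iff[symmetric])
  then show "\<delta> \<in> carrier M" "p \<delta> = mset_set X" using d by auto
qed

lemma subset_mset_set_iff:
  assumes "set_mset m \<subseteq> X"
  shows "m \<subseteq># mset_set X \<longleftrightarrow> (\<forall>a. count m a \<le> 1)"
proof -
  have "count m a \<le> count (mset_set X) a \<longleftrightarrow> count m a \<le> 1" for a
    using assms finite_X by (cases "a \<in> X") (auto simp: not_in_iff subset_iff)
  then show ?thesis by (simp add: subseteq_mset_def)
qed

lemma left_divisors_\<delta>: "left_divisors M \<delta> = {x \<in> carrier M. p x \<subseteq># mset_set X}"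
  using \<delta> by (auto simp: left_divisors_def divides_iff)

lemma finite_left_divisors_\<delta>: "finite (left_divisors M \<delta>)"
proof (rule finite_imageD)
  have "p ` left_divisors M \<delta> \<subseteq> {m. m \<subseteq># mset_set X}" by (auto simp: left_divisors_\<delta>)
  moreover have "m \<in> mset_set ` Pow X" if m: "m \<subseteq># mset_set X" for m
  proof
    show X: "set_mset m \<in> Pow X" using set_mset_mono[OF m] finite_X by simp
    have "count m a \<le> 1" for a using subset_mset_set_iff[of m] X m by simp
    then show "m = mset_set (set_mset m)"
      by (intro multiset_eqI) (metis One_nat_def count_eq_zero_iff count_mset_set(1,3) finite_set_mset
          le_Suc_eq le_zero_eq)
  qed
  ultimately have "p ` left_divisors M \<delta> \<subseteq> mset_set ` Pow X" by blast
  then show "finite (p ` left_divisors M \<delta>)" using finite_X finite_subset by blast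
  show "inj_on p (left_divisors M \<delta>)"
    using p_eq_iff by (auto simp: inj_on_def left_divisors_def)
qed

lemma generates_left_divisors_\<delta>: "generates_monoid M (left_divisors M \<delta>)"
proof -
  have "atoms M \<subseteq> left_divisors M \<delta>"
  proof
    fix x assume "x \<in> atoms M"
    then have x: "x \<in> carrier M" "size (p x) = 1" by (auto simp: atoms_eq)
    then obtain a where "p x = {#a#}" using size_1_singleton_mset by blast
    then have "p x \<subseteq># mset_set X" using p_set[OF x(1)] finite_X by auto
    then show "x \<in> left_divisors M \<delta>" using x by (simp add: left_divisors_\<delta>)
  qed
  then have "lists (atoms M) \<subseteq> lists (left_divisors M \<delta>)" by (rule lists_mono)
  then show ?thesis using generated_by_atoms
    unfolding generates_monoid_def left_divisors_def by blast
qed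

text \<open>The image of \<open>p x\<close> under the permutation \<open>\<phi>\<^sub>y\<close> is a part of the square-free multiset \<open>p \<delta>\<close>;
hence \<open>p x\<close> is square-free itself, and thus a part of \<open>p \<delta>\<close>.\<close>

lemma right_divisors_\<delta>_subset: "right_divisors M \<delta> \<subseteq> left_divisors M \<delta>"
proof
  fix x assume "x \<in> right_divisors M \<delta>"
  then obtain y where x: "x \<in> carrier M" and y: "y \<in> carrier M" "\<delta> = y \<otimes> x"
    by (auto simp: right_divisors_def factor_def op_monoid_def)
  have "image_mset (\<phi> y) (p x) \<subseteq># mset_set X"
    using p_mult[OF y(1) x] y(2) \<delta>(2) mset_subset_eq_add_right[of "image_mset (\<phi> y) (p x)" "p y"]
    by simp
  have cnt: "count (p x) a \<le> 1" for a
  proof (cases "a \<in> X")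
    case True
    have "count (p x) a \<le> count (image_mset (\<phi> y) (p x)) (\<phi> y a)"
      by (cases "a \<in># p x") (auto simp: count_image_mset not_in_iff intro!: member_le_sum)
    also have "\<dots> \<le> count (mset_set X) (\<phi> y a)"
      using \<open>image_mset (\<phi> y) (p x) \<subseteq># mset_set X\<close> by (simp add: subseteq_mset_def)
    also have "\<dots> \<le> 1" by (cases "\<phi> y a \<in> X") (simp_all add: finite_X)
    finally show ?thesis .
  next
    case False
    then show ?thesis using p_set[OF x] by (metis count_eq_zero_iff le0 subset_iff)
  qed
  then have "p x \<subseteq># mset_set X" using subset_mset_set_iff p_set[OF x] by blast
  then show "x \<in> left_divisors M \<delta>" using x by (simp add: left_divisors_\<delta>)
qed

text \<open>Sending a left divisor to its cofactor in \<open>\<delta>\<close> is injective by right cancellation, so \<open>\<delta>\<close> has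
at least as many right divisors as left divisors. Hence the inclusion above is an equality.\<close>

lemma garside_element_\<delta>:
  assumes right_cancel:
    "\<And>x y z. \<lbrakk>x \<in> carrier M; y \<in> carrier M; z \<in> carrier M; x \<otimes> z = y \<otimes> z\<rbrakk> \<Longrightarrow> x = y"
  shows "garside_element M \<delta>"
proof -
  define q where "q x = (SOME y. y \<in> carrier M \<and> \<delta> = x \<otimes> y)" for x
  have q: "q x \<in> carrier M \<and> \<delta> = x \<otimes> q x" if "x \<in> left_divisors M \<delta>" for x
  proof -
    have "\<exists>y. y \<in> carrier M \<and> \<delta> = x \<otimes> y" using that by (auto simp: left_divisors_def factor_def)
    then show ?thesis unfolding q_def by (rule someI_ex)
  qed
  have "q ` left_divisors M \<delta> \<subseteq> right_divisors M \<delta>"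
    using q by (fastforce simp: right_divisors_def left_divisors_def factor_def op_monoid_def)
  moreover have "inj_on q (left_divisors M \<delta>)"
  proof (rule inj_onI)
    fix x y assume x: "x \<in> left_divisors M \<delta>" and y: "y \<in> left_divisors M \<delta>" and "q x = q y"
    then have "x \<otimes> q x = y \<otimes> q x" using q[OF x] q[OF y] by metis
    moreover have "x \<in> carrier M" "y \<in> carrier M" "q x \<in> carrier M"
      using q[OF x] x y by (auto simp: left_divisors_def)
    ultimately show "x = y" by (metis right_cancel)
  qed
  moreover have fin: "finite (right_divisors M \<delta>)"
    using right_divisors_\<delta>_subset finite_left_divisors_\<delta> finite_subset by blast
  ultimately have "card (left_divisors M \<delta>) \<le> card (right_divisors M \<delta>)"
    by (metis card_inj_on_le)
  then have "left_divisors M \<delta> = right_divisors M \<delta>"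
    using right_divisors_\<delta>_subset finite_left_divisors_\<delta> by (metis card_seteq)
  then show ?thesis using \<delta> finite_left_divisors_\<delta> generates_left_divisors_\<delta>
    by (simp add: garside_element_def)
qed

text \<open>The letters \<open>y\<close> whose atom is a complement \<open>b \ a\<close>, where \<open>a\<close> stands for the atom with this letter.
Only elements \<open>b\<close> that \<open>a\<close> does not divide have a nontrivial complement.\<close>

definition complement_set :: "'b \<Rightarrow> 'b set" where
  "complement_set a = {y \<in> X. \<exists>b\<in>carrier M. a \<notin># p b \<and> \<phi> b y = a}"

lemma mem_complement_set_self:
  assumes "a \<in> X" shows "a \<in> complement_set a"
proof -
  have "set_mset {#a#} \<subseteq> X" using assms by simp
  then obtain x where x: "x \<in> carrier M" "p x = {#a#}" by (rule p_surj)
  have "p (\<one> \<otimes> x) = image_mset (\<phi> \<one>) (p x)" using p_mult[of \<one> x] x p_one by simp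
  then have "\<phi> \<one> a = a" using x by simp
  then show ?thesis using assms p_one by (force simp: complement_set_def)
qed

text \<open>The union of \<open>p b\<close> and \<open>{a}\<close> exceeds \<open>p b\<close> by \<open>a\<close> or by nothing, and the complement is
obtained by applying the inverse of \<open>\<phi>\<^sub>b\<close> to this excess.\<close>

lemma right_complement_iff:
  assumes "b \<in> carrier M" "x \<in> carrier M" "p x = {#a#}" "c \<in> carrier M"
  shows "is_right_complement M b x c \<longleftrightarrow>
    (if a \<in># p b then p c = {#} else \<exists>y\<in>X. \<phi> b y = a \<and> p c = {#y#})"
proof -
  have "is_right_complement M b x c \<longleftrightarrow> p b + image_mset (\<phi> b) (p c) = p b \<union># {#a#}"
    using assms lcm_iff[of b x "b \<otimes> c"] p_mult[of b c] by (simp add: is_right_complement_def)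
  also have "p b \<union># {#a#} = (if a \<in># p b then p b else p b + {#a#})"
    by (rule multiset_eqI) (auto simp: not_in_iff)
  moreover have "image_mset (\<phi> b) (p c) = {#a#} \<longleftrightarrow> (\<exists>y\<in>X. \<phi> b y = a \<and> p c = {#y#})"
  proof
    assume *: "image_mset (\<phi> b) (p c) = {#a#}"
    then have "size (p c) = 1" by (metis size_image_mset size_single)
    then obtain y where "p c = {#y#}" using size_1_singleton_mset by blast
    then show "\<exists>y\<in>X. \<phi> b y = a \<and> p c = {#y#}" using * p_set[OF assms(4)] by auto
  qed auto
  ultimately show ?thesis by simp
qed

text \<open>A multiset contains all these one-letter complements if and only if it contains the square-free
multiset on their letters.\<close>

lemma is_Delta_iff:
  assumes x: "x \<in> carrier M" "p x = {#a#}" and d: "d \<in> carrier M"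
  shows "is_Delta M x d \<longleftrightarrow> p d = mset_set (complement_set a)"
proof -
  let ?C = "{c. \<exists>b\<in>carrier M. is_right_complement M b x c}" and ?O = "complement_set a"
  have OX: "?O \<subseteq> X" by (auto simp: complement_set_def)
  then have finO: "finite ?O" using finite_X finite_subset by blast
  have C: "(\<forall>c\<in>?C. c divides e) \<longleftrightarrow> mset_set ?O \<subseteq># p e" if e: "e \<in> carrier M" for e
  proof
    assume L: "\<forall>c\<in>?C. c divides e"
    have "y \<in># p e" if y: "y \<in> ?O" for y
    proof -
      obtain b where b: "b \<in> carrier M" "a \<notin># p b" "\<phi> b y = a"
        using y by (auto simp: complement_set_def)
      have yX: "y \<in> X" using y OX by auto
      then obtain c where c: "c \<in> carrier M" "p c = {#y#}" using p_surj[of "{#y#}"] by auto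
      have "is_right_complement M b x c"
        using right_complement_iff[OF b(1) x c(1)] b c yX by auto
      then have "c divides e" using L b by blast
      then show ?thesis using divides_iff c e by simp
    qed
    then show "mset_set ?O \<subseteq># p e"
      using finO by (auto simp: subseteq_mset_def count_mset_set' Suc_le_eq)
  next
    assume R: "mset_set ?O \<subseteq># p e"
    show "\<forall>c\<in>?C. c divides e"
    proof
      fix c assume "c \<in> ?C"
      then obtain b where b: "b \<in> carrier M" "is_right_complement M b x c" by blast
      then have c: "c \<in> carrier M" by (simp add: is_right_complement_def)
      have "p c = {#} \<or> (\<exists>y\<in>?O. p c = {#y#})"
        using right_complement_iff[OF b(1) x c] b by (auto simp: complement_set_def split: if_splits)
      then have "p c \<subseteq># mset_set ?O" using finO by auto
      then show "c divides e" using divides_iff c e R by (meson subset_mset.order_trans)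
    qed
  qed
  have "is_Delta M x d \<longleftrightarrow> mset_set ?O \<subseteq># p d \<and>
      (\<forall>e\<in>carrier M. mset_set ?O \<subseteq># p e \<longrightarrow> p d \<subseteq># p e)"
    unfolding is_Delta_def is_right_lcm_set_def using C d divides_iff by auto
  also have "\<dots> \<longleftrightarrow> p d = mset_set ?O"
  proof
    assume *: "mset_set ?O \<subseteq># p d \<and> (\<forall>e\<in>carrier M. mset_set ?O \<subseteq># p e \<longrightarrow> p d \<subseteq># p e)"
    obtain e where "e \<in> carrier M" "p e = mset_set ?O"
      using p_surj[of "mset_set ?O"] OX finO by auto
    then show "p d = mset_set ?O" using * by (metis subset_mset.antisym subset_mset.order_refl)
  qed auto
  finally show ?thesis .
qed

text \<open>Each letter lies in its own complement set, so these sets can only coincide if they are all of \<open>X\<close>.\<close>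

lemma Delta_pure_iff: "Delta_pure M \<longleftrightarrow> (\<forall>a\<in>X. complement_set a = X)"
proof
  assume pure: "Delta_pure M"
  have "b \<in> complement_set a" if a: "a \<in> X" and b: "b \<in> X" for a b
  proof -
    obtain x where x: "x \<in> carrier M" "p x = {#a#}" using p_surj[of "{#a#}"] a by auto
    obtain y where y: "y \<in> carrier M" "p y = {#b#}" using p_surj[of "{#b#}"] b by auto
    have "x \<in> atoms M" "y \<in> atoms M" using x y by (auto simp: atoms_eq)
    then obtain d where d: "is_Delta M x d" "is_Delta M y d" using pure by (auto simp: Delta_pure_def)
    then have "d \<in> carrier M" by (simp add: is_Delta_def is_right_lcm_set_def)
    then have "mset_set (complement_set a) = mset_set (complement_set b)"
      using is_Delta_iff x y d by metis
    moreover have "finite (complement_set c)" for c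
      using finite_X by (auto simp: complement_set_def)
    ultimately have "complement_set a = complement_set b" by (metis finite_set_mset_mset_set)
    then show ?thesis using mem_complement_set_self[OF b] by simp
  qed
  then show "\<forall>a\<in>X. complement_set a = X" by (auto simp: complement_set_def)
next
  assume full: "\<forall>a\<in>X. complement_set a = X"
  have "is_Delta M x \<delta>" if x: "x \<in> atoms M" for x
  proof -
    have xc: "x \<in> carrier M" "size (p x) = 1" using x by (auto simp: atoms_eq)
    then obtain a where a: "p x = {#a#}" using size_1_singleton_mset by blast
    then have "a \<in> X" using p_set[OF xc(1)] by auto
    then show ?thesis using is_Delta_iff[OF xc(1) a \<delta>(1)] \<delta>(2) full by simp
  qed
  then show "Delta_pure M" by (auto simp: Delta_pure_def)
qed

end

text \<open>The coordinates of the opposite monoid contribute right cancellation, right gcds and left lcms; all else,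
including the Garside element, comes from those of \<open>M\<close>.\<close>

theorem garside_monoid_if_coordinates:
  assumes L: "multiset_coordinates M X p \<phi>"
    and R: "multiset_coordinates (op_monoid M) X p' \<phi>'"
  shows "garside_monoid M"
proof -
  interpret L: multiset_coordinates M X p \<phi> by (rule L)
  interpret R: multiset_coordinates "op_monoid M" X p' \<phi>' by (rule R)
  have [simp]: "carrier (op_monoid M) = carrier M" "mult (op_monoid M) = (\<lambda>x y. y \<otimes>\<^bsub>M\<^esub> x)"
    by (simp_all add: op_monoid_def)
  have rc: "x = y" if "x \<in> carrier M" "y \<in> carrier M" "z \<in> carrier M" "x \<otimes>\<^bsub>M\<^esub> z = y \<otimes>\<^bsub>M\<^esub> z" for x y z
    using R.left_cancel[of x y z] that by simp
  have "monoid_cancel M"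
    by (unfold_locales) (use L.left_cancel rc in blast)+
  then have "gaussian_monoid M"
    unfolding gaussian_monoid_def
    using L.atomic L.ex_gcd L.ex_lcm R.ex_gcd R.ex_lcm by simp
  moreover have "garside_element M L.\<delta>" by (rule L.garside_element_\<delta>[OF rc])
  ultimately show ?thesis by (auto simp: garside_monoid_def)
qed

section \<open>Presented monoids\<close>

lemma equiv_word_cong: "equiv (lists X) (word_cong X R)"
proof (rule equivI)
  have "u \<in> lists X \<and> v \<in> lists X" if "(u, v) \<in> word_cong X R" for u v
    using that by induction auto
  then show "word_cong X R \<subseteq> lists X \<times> lists X" by auto
  show "refl_on (lists X) (word_cong X R)"
    by (auto intro: refl_onI word_cong_refl)
  show "sym (word_cong X R)" by (auto intro: symI word_cong_sym)
  show "trans (word_cong X R)" by (auto intro: transI word_cong_trans)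
qed

lemma word_cong_context:
  assumes "(u, v) \<in> word_cong X R" "a \<in> lists X" "b \<in> lists X"
  shows "(a @ u @ b, a @ v @ b) \<in> word_cong X R"
  using assms
proof (induction)
  case (word_cong_rel u v c d)
  then have "((a @ c) @ u @ (d @ b), (a @ c) @ v @ (d @ b)) \<in> word_cong X R"
    by (intro word_cong.word_cong_rel) auto
  then show ?case by simp
next
  case (word_cong_refl u)
  then show ?case by (intro word_cong.word_cong_refl) auto
next
  case (word_cong_sym u v)
  then show ?case by (simp add: word_cong.word_cong_sym)
next
  case (word_cong_trans u v w)
  then show ?case by (simp add: word_cong.word_cong_trans[OF word_cong_trans.IH])
qed

abbreviation word_class :: "'a set \<Rightarrow> ('a list \<times> 'a list) set \<Rightarrow> 'a list \<Rightarrow> 'a list set" where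
  "word_class X R u \<equiv> word_cong X R `` {u}"

lemma word_class_eq_iff:
  assumes "u \<in> lists X" "v \<in> lists X"
  shows "word_class X R u = word_class X R v \<longleftrightarrow> (u, v) \<in> word_cong X R"
  using eq_equiv_class_iff[OF equiv_word_cong] assms by metis

lemma presented_mult:
  assumes u: "u \<in> lists X" and v: "v \<in> lists X"
  shows "word_class X R u \<otimes>\<^bsub>presented_monoid X R\<^esub> word_class X R v = word_class X R (u @ v)"
proof -
  have sub: "a \<in> lists X" "b \<in> lists X" if "(a, b) \<in> word_cong X R" for a b
    using that equiv_word_cong[of X R] by (auto simp: equiv_def)
  have "word_class X R (a @ b) = word_class X R (u @ v)"
    if a: "a \<in> word_class X R u" and b: "b \<in> word_class X R v" for a b
  proof -
    have "([] @ u @ v, [] @ a @ v) \<in> word_cong X R"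
      using a v by (intro word_cong_context) auto
    moreover have "(a @ v @ [], a @ b @ []) \<in> word_cong X R"
      using a b sub by (intro word_cong_context) auto
    ultimately have "(u @ v, a @ b) \<in> word_cong X R"
      using word_cong_trans by fastforce
    then show ?thesis using equiv_class_eq[OF equiv_word_cong] by metis
  qed
  moreover have "u \<in> word_class X R u" "v \<in> word_class X R v"
    using u v by (auto intro: word_cong_refl)
  ultimately have "(\<Union>a\<in>word_class X R u. \<Union>b\<in>word_class X R v. word_class X R (a @ b))
      = word_class X R (u @ v)"
    by blast
  then show ?thesis by (simp add: presented_monoid_def)
qed

lemma presented_carrier: "carrier (presented_monoid X R) = word_class X R ` lists X"
  by (auto simp: presented_monoid_def quotient_def)

lemma presented_one: "\<one>\<^bsub>presented_monoid X R\<^esub> = word_class X R []"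
  by (simp add: presented_monoid_def)

lemma monoid_presented: "monoid (presented_monoid X R)"
proof
  have "word_class X R [] \<in> word_class X R ` lists X" by blast
  then show "\<one>\<^bsub>presented_monoid X R\<^esub> \<in> carrier (presented_monoid X R)"
    by (simp add: presented_carrier presented_one)
next
  fix x y assume "x \<in> carrier (presented_monoid X R)" "y \<in> carrier (presented_monoid X R)"
  then obtain u v where "u \<in> lists X" "v \<in> lists X" "x = word_class X R u" "y = word_class X R v"
    by (auto simp: presented_carrier)
  then show "x \<otimes>\<^bsub>presented_monoid X R\<^esub> y \<in> carrier (presented_monoid X R)"
    using presented_mult presented_carrier by (metis append_in_lists_conv imageI)
next
  fix x y z assume "x \<in> carrier (presented_monoid X R)" "y \<in> carrier (presented_monoid X R)"
    "z \<in> carrier (presented_monoid X R)"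
  then obtain u v w where "u \<in> lists X" "v \<in> lists X" "w \<in> lists X"
    "x = word_class X R u" "y = word_class X R v" "z = word_class X R w"
    by (auto simp: presented_carrier)
  then show "x \<otimes>\<^bsub>presented_monoid X R\<^esub> y \<otimes>\<^bsub>presented_monoid X R\<^esub> z =
      x \<otimes>\<^bsub>presented_monoid X R\<^esub> (y \<otimes>\<^bsub>presented_monoid X R\<^esub> z)"
    by (simp add: presented_mult)
next
  fix x assume "x \<in> carrier (presented_monoid X R)"
  then obtain u where "u \<in> lists X" "x = word_class X R u" by (auto simp: presented_carrier)
  then show "\<one>\<^bsub>presented_monoid X R\<^esub> \<otimes>\<^bsub>presented_monoid X R\<^esub> x = x"
    "x \<otimes>\<^bsub>presented_monoid X R\<^esub> \<one>\<^bsub>presented_monoid X R\<^esub> = x"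
    by (simp_all add: presented_one presented_mult)
qed

lemma monoid_op: "monoid M \<Longrightarrow> monoid (op_monoid M)"
  by (unfold_locales) (auto simp: op_monoid_def monoid.m_assoc monoid.one_closed monoid.m_closed
      monoid.l_one monoid.r_one)

text \<open>A chosen word in a class, so that functions on words induce functions on the monoid without a proof
that they are constant on classes.\<close>

definition word_rep :: "'a set \<Rightarrow> 'a list set \<Rightarrow> 'a list" where
  "word_rep X A = (SOME u. u \<in> A \<and> u \<in> lists X)"

lemma word_rep:
  assumes "A \<in> carrier (presented_monoid X R)"
  shows "word_rep X A \<in> lists X" "word_class X R (word_rep X A) = A"
proof -
  obtain u where u: "u \<in> lists X" "A = word_class X R u" using assms by (auto simp: presented_carrier)
  then have "u \<in> A \<and> u \<in> lists X" by (auto intro: word_cong_refl)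
  then have *: "word_rep X A \<in> A \<and> word_rep X A \<in> lists X"
    unfolding word_rep_def by (rule someI)
  then show "word_rep X A \<in> lists X" by simp
  show "word_class X R (word_rep X A) = A"
    using * u by (metis Image_singleton_iff word_class_eq_iff)
qed

text \<open>A complete invariant \<open>c\<close> of words modulo the relations, with values in multisets. Whether it yields
coordinates of the presented monoid or of its opposite depends on how it behaves on concatenations.\<close>

locale word_coordinates =
  fixes X :: "'a set" and R :: "('a list \<times> 'a list) set"
    and c :: "'a list \<Rightarrow> 'a multiset" and act :: "'a list \<Rightarrow> 'a \<Rightarrow> 'a"
  assumes fin: "finite X"
    and cong_iff: "\<lbrakk>u \<in> lists X; v \<in> lists X\<rbrakk> \<Longrightarrow> (u, v) \<in> word_cong X R \<longleftrightarrow> c u = c v"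
    and c_image: "c ` lists X = {m. set_mset m \<subseteq> X}"
    and act_bij: "u \<in> lists X \<Longrightarrow> bij_betw (act u) X X"
begin

abbreviation "P \<equiv> presented_monoid X R"
abbreviation "coord A \<equiv> c (word_rep X A)"
abbreviation "act_class A \<equiv> act (word_rep X A)"

lemma coord_class: "u \<in> lists X \<Longrightarrow> coord (word_class X R u) = c u"
proof -
  assume u: "u \<in> lists X"
  then have "word_class X R u \<in> carrier P" by (auto simp: presented_carrier)
  note rep = word_rep[OF this]
  then have "(word_rep X (word_class X R u), u) \<in> word_cong X R"
    using word_class_eq_iff[OF rep(1) u] by simp
  then show ?thesis using cong_iff rep(1) u by blast
qed

lemma coord_bij: "bij_betw coord (carrier P) {m. set_mset m \<subseteq> X}"
proof (rule bij_betw_imageI)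
  show "inj_on coord (carrier P)"
  proof (rule inj_onI)
    fix A B assume A: "A \<in> carrier P" and B: "B \<in> carrier P" and "coord A = coord B"
    then have "(word_rep X A, word_rep X B) \<in> word_cong X R" using cong_iff word_rep by metis
    then show "A = B" using word_rep[OF A] word_rep[OF B] word_class_eq_iff by metis
  qed
  have "coord ` carrier P = c ` lists X"
    by (simp add: presented_carrier image_image coord_class cong: image_cong)
  then show "coord ` carrier P = {m. set_mset m \<subseteq> X}" using c_image by simp
qed

lemma coord_mult:
  assumes "A \<in> carrier P" "B \<in> carrier P"
  shows "coord (A \<otimes>\<^bsub>P\<^esub> B) = c (word_rep X A @ word_rep X B)"
proof -
  have "A \<otimes>\<^bsub>P\<^esub> B = word_class X R (word_rep X A @ word_rep X B)"
    using presented_mult[of "word_rep X A" X "word_rep X B" R] word_rep assms by metis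
  moreover have "word_rep X A @ word_rep X B \<in> lists X" using word_rep(1) assms by force
  ultimately show ?thesis using coord_class by simp
qed

lemma left_coordinates:
  assumes "\<And>u v. \<lbrakk>u \<in> lists X; v \<in> lists X\<rbrakk> \<Longrightarrow> c (u @ v) = c u + image_mset (act u) (c v)"
  shows "multiset_coordinates P X coord act_class"
proof -
  interpret monoid P by (rule monoid_presented)
  show ?thesis
    by unfold_locales (simp_all only: fin coord_bij coord_mult assms word_rep(1) act_bij)
qed

lemma right_coordinates:
  assumes "\<And>u v. \<lbrakk>u \<in> lists X; v \<in> lists X\<rbrakk> \<Longrightarrow> c (u @ v) = c v + image_mset (act v) (c u)"
  shows "multiset_coordinates (op_monoid P) X coord act_class"
proof -
  interpret monoid "op_monoid P" by (intro monoid_op monoid_presented)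
  have [simp]: "carrier (op_monoid P) = carrier P" "mult (op_monoid P) = (\<lambda>x y. y \<otimes>\<^bsub>P\<^esub> x)"
    by (simp_all add: op_monoid_def)
  show ?thesis
    by unfold_locales (simp_all add: fin coord_bij coord_mult assms word_rep(1) act_bij)
qed

end

section \<open>Words over a solution\<close>

text \<open>The multiset of the letters \<open>g\<^bsub>x\<^sub>1\<^esub> \<dots> g\<^bsub>x\<^sub>i\<^sub>-\<^sub>1\<^esub> x\<^sub>i\<close> of a word \<open>x\<^sub>1 \<dots> x\<^sub>n\<close>. For
a solution, these are the atoms that left-divide the element that the word represents.\<close>

fun content :: "('a \<times> 'a \<Rightarrow> 'a \<times> 'a) \<Rightarrow> 'a list \<Rightarrow> 'a multiset" where
  "content S [] = {#}"
| "content S (x # w) = add_mset x (image_mset (gmap S x) (content S w))"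

abbreviation word_action :: "('a \<times> 'a \<Rightarrow> 'a \<times> 'a) \<Rightarrow> 'a list \<Rightarrow> 'a \<Rightarrow> 'a" where
  "word_action S \<equiv> foldr (gmap S)"

lemma content_append:
  "content S (u @ v) = content S u + image_mset (word_action S u) (content S v)"
  by (induction u) (auto simp: multiset.map_comp comp_def)

lemma size_content: "size (content S w) = length w"
  by (induction w) auto

text \<open>Reading words backwards turns the relations of \<open>S\<close> into those of the opposite solution, in which the
maps \<open>f\<close> and \<open>g\<close> change places.\<close>

definition opposite :: "('a \<times> 'a \<Rightarrow> 'a \<times> 'a) \<Rightarrow> 'a \<times> 'a \<Rightarrow> 'a \<times> 'a" where
  "opposite S = prod.swap \<circ> S \<circ> prod.swap"

locale solution =
  fixes X :: "'a set" and S :: "'a \<times> 'a \<Rightarrow> 'a \<times> 'a"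
  assumes finite: "finite X" and nondegenerate: "nondegenerate X S"
    and involutive: "involutive X S" and braided: "braided X S"
begin

lemma g_bij: "x \<in> X \<Longrightarrow> bij_betw (gmap S x) X X"
  using nondegenerate by (simp add: nondegenerate_def)

lemma g_closed: "\<lbrakk>x \<in> X; y \<in> X\<rbrakk> \<Longrightarrow> gmap S x y \<in> X"
  using g_bij bij_betwE by blast

lemma g_inj: "\<lbrakk>x \<in> X; y \<in> X; z \<in> X; gmap S x y = gmap S x z\<rbrakk> \<Longrightarrow> y = z"
  using g_bij[of x] by (auto simp: bij_betw_def inj_on_def)

lemma g_surj:
  assumes "x \<in> X" "y \<in> X"
  obtains z where "z \<in> X" "gmap S x z = y"
proof -
  have "y \<in> gmap S x ` X" using g_bij[OF assms(1)] assms(2) by (simp add: bij_betw_def)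
  then show thesis using that by blast
qed

lemma f_closed: "\<lbrakk>x \<in> X; y \<in> X\<rbrakk> \<Longrightarrow> fmap S y x \<in> X"
  using nondegenerate bij_betwE unfolding nondegenerate_def by blast

lemma S_eq: "S (x, y) = (gmap S x y, fmap S y x)"
  by (simp add: gmap_def fmap_def)

lemma g_f:
  assumes "x \<in> X" "y \<in> X"
  shows "gmap S (gmap S x y) (fmap S y x) = x"
proof -
  have "S (S (x, y)) = (x, y)" using involutive assms by (simp add: involutive_def)
  then show ?thesis by (simp add: S_eq)
qed

text \<open>The first component of the braid relation: \<open>x \<mapsto> g\<^sub>x\<close> respects the defining relations of the
monoid. The third component is the same statement for the opposite solution.\<close>

lemma g_g:
  assumes "x \<in> X" "y \<in> X" "z \<in> X"
  shows "gmap S x (gmap S y z) = gmap S (gmap S x y) (gmap S (fmap S y x) z)"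
proof -
  have "S12 S (S23 S (S12 S (x, y, z))) = S23 S (S12 S (S23 S (x, y, z)))"
    using braided assms by (simp add: braided_def)
  then show ?thesis by (simp add: S12_def S23_def S_eq)
qed

lemma opposite: "solution X (opposite S)"
proof
  let ?T = "opposite S"
  have T: "?T (x, y) = (fmap S x y, gmap S y x)" for x y by (simp add: opposite_def S_eq)
  have *: "gmap ?T x = fmap S x" "fmap ?T x = gmap S x" for x
    by (auto simp: gmap_def fmap_def opposite_def)
  show "finite X" by (rule finite)
  show "nondegenerate X ?T" using nondegenerate by (simp add: nondegenerate_def *)
  show "involutive X ?T" using involutive by (auto simp: involutive_def opposite_def)
  show "braided X ?T"
    unfolding braided_def
  proof
    fix p assume "p \<in> X \<times> X \<times> X"
    then obtain x y z where p: "p = (x, y, z)" "x \<in> X" "y \<in> X" "z \<in> X" by auto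
    have "S12 S (S23 S (S12 S (z, y, x))) = S23 S (S12 S (S23 S (z, y, x)))"
      using braided p by (simp add: braided_def)
    then show "S12 ?T (S23 ?T (S12 ?T p)) = S23 ?T (S12 ?T (S23 ?T p))"
      unfolding p(1) by (simp add: S12_def S23_def S_eq T)
  qed
qed

lemma word_action_bij: "w \<in> lists X \<Longrightarrow> bij_betw (word_action S w) X X"
proof (induction w)
  case Nil then show ?case by (simp add: bij_betw_def)
next
  case (Cons x w)
  then show ?case using bij_betw_trans[of "word_action S w" X X "gmap S x" X] g_bij by (simp add: comp_def)
qed

lemma content_set: "w \<in> lists X \<Longrightarrow> set_mset (content S w) \<subseteq> X"
  by (induction w) (auto simp: g_closed subset_iff)

lemma inj_image_g:
  assumes x: "x \<in> X" and m: "set_mset m \<subseteq> X" and n: "set_mset n \<subseteq> X"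
    and eq: "image_mset (gmap S x) m = image_mset (gmap S x) n"
  shows "m = n"
  using image_mset_inv_into_cancel[OF bij_betw_imp_inj_on[OF g_bij[OF x]]] m n eq by metis

abbreviation "E \<equiv> word_cong X (structure_relations X S)"

lemma E_lists: "(u, v) \<in> E \<Longrightarrow> u \<in> lists X \<and> v \<in> lists X"
  using equiv_word_cong[of X "structure_relations X S"] by (auto simp: equiv_def)

text \<open>For a defining relation \<open>x y = t z\<close> with \<open>t = g\<^sub>x y\<close>, the contents \<open>{x, g\<^sub>x y}\<close> and
\<open>{t, g\<^sub>t z}\<close> agree because involutivity gives \<open>g\<^sub>t z = x\<close>. Inside a longer word the content also
depends on the action of the prefix, so both invariants have to be carried along.\<close>

lemma content_sound:
  assumes "(u, v) \<in> E"
  shows "content S u = content S v \<and> (\<forall>y\<in>X. word_action S u y = word_action S v y)"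
  using assms
proof induction
  case (word_cong_rel u v a b)
  then obtain x y where xy: "x \<in> X" "y \<in> X" "u = [x, y]" "v = [gmap S x y, fmap S y x]"
    by (auto simp: structure_relations_def S_eq)
  have act: "word_action S u z = word_action S v z" if "z \<in> X" for z
    using g_g xy that by simp
  have "content S u = content S v" using xy g_f by simp
  moreover have "image_mset (word_action S u) (content S b) = image_mset (word_action S v) (content S b)"
    using act content_set[OF word_cong_rel(5)] by (intro image_mset_cong) auto
  moreover have "word_action S b z \<in> X" if "z \<in> X" for z
    using that word_action_bij[OF word_cong_rel(5)] bij_betwE by blast
  ultimately show ?case using act by (simp add: content_append)
qed auto

text \<open>A letter of the content that comes from the tail of \<open>x w\<close> has the form \<open>g\<^sub>x b\<close>. If \<open>b\<close> has been
moved to the front of \<open>w\<close>, then the relation \<open>x b = (g\<^sub>x b) (f\<^sub>b x)\<close> moves it past \<open>x\<close>.\<close>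

lemma extract_letter:
  assumes "w \<in> lists X" "a \<in># content S w"
  shows "\<exists>w'. (w, a # w') \<in> E"
  using assms
proof (induction w arbitrary: a rule: list.induct)
  case (Cons x w)
  show ?case
  proof (cases "a = x")
    case True
    then have "(x # w, a # w) \<in> E" using True word_cong_refl[OF Cons.prems(1)] by blast
    then show ?thesis ..
  next
    case False
    then obtain b where b: "b \<in># content S w" "a = gmap S x b" using Cons.prems by auto
    have "w \<in> lists X" using Cons.prems by simp
    then obtain w' where w': "(w, b # w') \<in> E" using Cons.IH b(1) by blast
    have X: "x \<in> X" "b \<in> X" "w' \<in> lists X" using Cons.prems E_lists[OF w'] by auto
    have "(x # w, x # b # w') \<in> E"
      using word_cong_context[OF w', of "[x]" "[]"] X by simp
    moreover have "([] @ [x, b] @ w', [] @ [gmap S x b, fmap S b x] @ w') \<in> E"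
    proof (rule word_cong.word_cong_rel)
      show "([x, b], [gmap S x b, fmap S b x]) \<in> structure_relations X S"
        using X by (simp add: structure_relations_def S_eq)
    qed (use X g_closed f_closed in simp_all)
    ultimately have "(x # w, a # fmap S b x # w') \<in> E"
      unfolding b(2) append_Nil append_Cons by (rule word_cong_trans)
    then show ?thesis ..
  qed
qed simp

text \<open>Move the first letter of \<open>u\<close> to the front of \<open>v\<close> and cancel it: the contents of the tails agree
because \<open>g\<^sub>x\<close> is injective.\<close>

lemma content_complete:
  assumes "u \<in> lists X" "v \<in> lists X" "content S u = content S v"
  shows "(u, v) \<in> E"
  using assms
proof (induction u arbitrary: v rule: list.induct)
  case Nil
  then have "v = []" using size_content[of S v] by simp
  then show ?case by (simp add: word_cong_refl)
next
  case (Cons x u)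
  then have "x \<in># content S v" by (metis content.simps(2) union_single_eq_member)
  then obtain v' where v': "(v, x # v') \<in> E" using extract_letter Cons.prems by blast
  then have X: "x \<in> X" "u \<in> lists X" "v' \<in> lists X"
    using Cons.prems E_lists[OF v'] by (simp_all del: content.simps)
  have "content S (x # v') = content S (x # u)" using content_sound[OF v'] Cons.prems by simp
  then have "content S u = content S v'" using inj_image_g X content_set by simp
  then have "(u, v') \<in> E" using Cons.IH X by blast
  then have "(x # u, x # v') \<in> E" using word_cong_context[of u v' X _ "[x]" "[]"] X by simp
  then show ?case using word_cong_trans[OF _ word_cong_sym[OF v']] by blast
qed

lemma content_image: "content S ` lists X = {m. set_mset m \<subseteq> X}"
proof -
  have "m \<in> content S ` lists X" if "set_mset m \<subseteq> X" "size m = n" for m n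
    using that
  proof (induction n arbitrary: m)
    case 0
    then show ?case by (force intro: image_eqI[of _ _ "[]"])
  next
    case (Suc n)
    then obtain x m' where m: "m = add_mset x m'" by (metis size_eq_Suc_imp_eq_union)
    then have x: "x \<in> X" and m': "set_mset m' \<subseteq> X" "size m' = n" using Suc.prems by auto
    have im: "gmap S x ` X = X" using g_bij[OF x] by (simp add: bij_betw_def)
    let ?k = "image_mset (inv_into X (gmap S x)) m'"
    have "set_mset ?k \<subseteq> X" using m' im by (auto intro!: inv_into_into)
    then obtain w where w: "w \<in> lists X" "?k = content S w" using Suc.IH[of ?k] m' by auto
    have "image_mset (gmap S x) ?k = m'" by (rule image_mset_f_inv_into) (simp add: im m')
    then have "content S (x # w) = m" using m w(2) by simp
    then show ?case using w x by (intro image_eqI[of _ _ "x # w"]) auto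
  qed
  then show ?thesis using content_set by blast
qed

end

sublocale solution \<subseteq> left: word_coordinates X "structure_relations X S" "content S" "word_action S"
proof
  show "(u, v) \<in> E \<longleftrightarrow> content S u = content S v" if "u \<in> lists X" "v \<in> lists X" for u v
    using content_sound content_complete that by blast
qed (simp_all add: finite content_image word_action_bij)

lemma structure_cong_rev:
  assumes "(u, v) \<in> word_cong X (structure_relations X S)"
  shows "(rev u, rev v) \<in> word_cong X (structure_relations X (opposite S))"
  using assms
proof induction
  case (word_cong_rel u v a b)
  then have "(rev u, rev v) \<in> structure_relations X (opposite S)"
    by (auto simp: structure_relations_def opposite_def)
  then have "(rev b @ rev u @ rev a, rev b @ rev v @ rev a)
      \<in> word_cong X (structure_relations X (opposite S))"
    using word_cong_rel by (intro word_cong.word_cong_rel) auto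
  then show ?case by simp
next
  case (word_cong_refl u)
  then show ?case by (intro word_cong.word_cong_refl) auto
next
  case (word_cong_sym u v)
  then show ?case by (simp add: word_cong.word_cong_sym)
next
  case (word_cong_trans u v w)
  then show ?case by (simp add: word_cong.word_cong_trans[OF word_cong_trans.IH])
qed

context solution begin

lemma right_word_coordinates:
  "word_coordinates X (structure_relations X S) (\<lambda>w. content (opposite S) (rev w)) (\<lambda>w. word_action (opposite S) (rev w))"
proof -
  interpret opp: solution X "opposite S" by (rule opposite)
  have opp_opp: "opposite (opposite S) = S" by (simp add: fun_eq_iff opposite_def)
  show ?thesis
  proof
    fix u v assume uv: "u \<in> lists X" "v \<in> lists X"
    have "(u, v) \<in> E \<longleftrightarrow> (rev u, rev v) \<in> word_cong X (structure_relations X (opposite S))"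
      using structure_cong_rev[of u v X S] structure_cong_rev[of "rev u" "rev v" X "opposite S"] opp_opp
      by auto
    then show "(u, v) \<in> E \<longleftrightarrow> content (opposite S) (rev u) = content (opposite S) (rev v)"
      using opp.left.cong_iff[of "rev u" "rev v"] uv by (simp add: in_lists_conv_set)
  next
    have "(\<lambda>w. content (opposite S) (rev w)) ` lists X = content (opposite S) ` rev ` lists X"
      by (simp add: image_image)
    also have "rev ` lists X = lists X"
      by (auto simp: image_iff intro!: bexI[of _ "rev _"])
    finally show "(\<lambda>w. content (opposite S) (rev w)) ` lists X = {m. set_mset m \<subseteq> X}"
      using opp.content_image by simp
  qed (simp_all add: finite opp.word_action_bij in_lists_conv_set)
qed

lemma garside: "garside_monoid (structure_monoid X S)"
proof -
  interpret right: word_coordinates X "structure_relations X S"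
    "\<lambda>w. content (opposite S) (rev w)" "\<lambda>w. word_action (opposite S) (rev w)"
    by (rule right_word_coordinates)
  have "multiset_coordinates (structure_monoid X S) X left.coord left.act_class"
    unfolding structure_monoid_def by (rule left.left_coordinates) (simp add: content_append)
  moreover have "multiset_coordinates (op_monoid (structure_monoid X S)) X right.coord right.act_class"
    unfolding structure_monoid_def by (rule right.right_coordinates) (simp add: content_append)
  ultimately show ?thesis by (rule garside_monoid_if_coordinates)
qed

section \<open>Decompositions\<close>

text \<open>The complement set of \<open>a\<close> in the structure monoid, in terms of words.\<close>

definition reach :: "'a \<Rightarrow> 'a set" where
  "reach a = {y \<in> X. \<exists>w\<in>lists X. a \<notin># content S w \<and> word_action S w y = a}"

lemma Delta_pure_iff_reach: "Delta_pure (structure_monoid X S) \<longleftrightarrow> (\<forall>a\<in>X. reach a = X)"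
proof -
  interpret C: multiset_coordinates "structure_monoid X S" X left.coord left.act_class
    unfolding structure_monoid_def by (rule left.left_coordinates) (simp add: content_append)
  have "C.complement_set a = reach a" for a
  proof (intro equalityI subsetI)
    fix y assume "y \<in> C.complement_set a"
    then obtain A where "y \<in> X" "A \<in> carrier (structure_monoid X S)"
      "a \<notin># left.coord A" "left.act_class A y = a"
      by (auto simp: C.complement_set_def)
    then show "y \<in> reach a"
      using word_rep(1)[of A X "structure_relations X S"] by (auto simp: reach_def structure_monoid_def)
  next
    fix y assume "y \<in> reach a"
    then obtain w where y: "y \<in> X" and w: "w \<in> lists X" "a \<notin># content S w" "word_action S w y = a"
      by (auto simp: reach_def)
    let ?A = "word_class X (structure_relations X S) w"
    have A: "?A \<in> carrier (structure_monoid X S)"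
      using w by (auto simp: presented_carrier structure_monoid_def)
    note rep = word_rep[OF this[unfolded structure_monoid_def]]
    have "(word_rep X ?A, w) \<in> E" using word_class_eq_iff[OF rep(1) w(1)] rep(2) by simp
    then have "word_action S (word_rep X ?A) y = a" "a \<notin># content S (word_rep X ?A)"
      using content_sound w y by auto
    then show "y \<in> C.complement_set a"
      using A y by (auto simp: C.complement_set_def)
  qed
  then show ?thesis using C.Delta_pure_iff by simp
qed

lemma reach_self: "a \<in> X \<Longrightarrow> a \<in> reach a"
  by (auto simp: reach_def intro!: bexI[of _ "[]"])

text \<open>Appending \<open>y\<close> to a word \<open>w\<close> that sends \<open>c = g\<^sub>y d\<close> to \<open>a\<close> adds the image of \<open>y\<close> under \<open>w\<close>
to its content. This differs from \<open>a\<close> exactly if \<open>y \<noteq> c\<close>.\<close>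

lemma reach_step:
  assumes "gmap S y d \<in> reach a" "y \<in> X" "d \<in> X" "y \<noteq> gmap S y d"
  shows "d \<in> reach a"
proof -
  obtain w where w: "w \<in> lists X" "a \<notin># content S w" "word_action S w (gmap S y d) = a"
    using assms by (auto simp: reach_def)
  have "word_action S w y \<noteq> a"
    using w(3) assms word_action_bij[OF w(1)] g_closed[OF assms(2,3)]
    by (metis bij_betw_def inj_on_def)
  then have "a \<notin># content S (w @ [y])" "word_action S (w @ [y]) d = a" "w @ [y] \<in> lists X"
    using w assms by (auto simp: content_append)
  then show ?thesis using assms(3) unfolding reach_def by blast
qed

text \<open>If \<open>g\<^sub>x t = x\<close>, then \<open>S\<close> sends \<open>(x, t)\<close> to a pair \<open>(x, u)\<close>, and applying \<open>S\<close> again yields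
\<open>g\<^sub>x u = x\<close>, so that \<open>u = t\<close>. Hence \<open>f\<^sub>t x = t\<close>, which determines \<open>x\<close> in terms of \<open>t\<close>
as \<open>f\<^sub>t\<close> is injective.\<close>

lemma diagonal_inj:
  assumes "x \<in> X" "y \<in> X" "t \<in> X" "gmap S x t = x" "gmap S y t = y"
  shows "x = y"
proof -
  have "fmap S t x = t" if "x \<in> X" "gmap S x t = x" for x
  proof -
    have "gmap S x (fmap S t x) = x" using g_f[of x t] that assms by simp
    then show ?thesis using g_inj that assms f_closed by metis
  qed
  then have "fmap S t x = fmap S t y" using assms by metis
  moreover have "inj_on (fmap S t) X"
    using nondegenerate assms by (auto simp: nondegenerate_def bij_betw_def)
  ultimately show ?thesis using assms by (auto simp: inj_on_def)
qed

lemma g_image_eq: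
  assumes "x \<in> X" "Y \<subseteq> X" "gmap S x ` Y \<subseteq> Y"
  shows "gmap S x ` Y = Y"
proof (rule endo_inj_surj)
  show "inj_on (gmap S x) Y"
    using g_bij[OF assms(1)] assms(2) by (auto simp: bij_betw_def intro: inj_on_subset)
qed (use assms finite finite_subset in auto)

lemma g_image_complement:
  assumes "x \<in> X" "Y \<subseteq> X" "gmap S x ` Y = Y"
  shows "gmap S x ` (X - Y) = X - Y"
  using inj_on_image_set_diff[of "gmap S x" X X Y] g_bij[OF assms(1)] assms
  by (simp add: bij_betw_def)

text \<open>Invariance under the maps \<open>f\<close> comes for free: by involutivity \<open>f\<^sub>y x\<close> is the preimage of \<open>x\<close>
under \<open>g\<^sub>t\<close> with \<open>t = g\<^sub>x y\<close>.\<close>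

lemma nondegenerate_invariant:
  assumes Y: "Y \<subseteq> X" and g: "\<And>x. x \<in> X \<Longrightarrow> gmap S x ` Y = Y"
  shows "nondegenerate_invariant_subset X S Y"
proof -
  have gY: "gmap S x y \<in> Y" if "x \<in> X" "y \<in> Y" for x y
    using imageI[OF that(2), of "gmap S x"] g[OF that(1)] by simp
  have fY: "fmap S y x \<in> Y" if x: "x \<in> Y" and y: "y \<in> X" for x y
  proof -
    have X: "x \<in> X" "gmap S x y \<in> X" using Y x y g_closed by auto
    have "x \<in> gmap S (gmap S x y) ` Y" using x by (simp add: g[OF X(2)])
    then obtain d where d: "d \<in> Y" "gmap S (gmap S x y) d = x" by auto
    have "gmap S (gmap S x y) (fmap S y x) = x" "fmap S y x \<in> X" "d \<in> X"
      using g_f f_closed X y Y d by auto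
    then have "d = fmap S y x" using g_inj[OF X(2)] d by metis
    then show ?thesis using d by simp
  qed
  have "bij_betw (fmap S x) Y Y" if "x \<in> Y" for x
  proof -
    have x: "x \<in> X" using that Y by auto
    have "inj_on (fmap S x) Y"
      using nondegenerate x inj_on_subset[OF _ Y] by (auto simp: nondegenerate_def bij_betw_def)
    moreover have "fmap S x ` Y \<subseteq> Y" using fY x by auto
    moreover have "finite Y" using finite Y by (rule rev_finite_subset)
    ultimately show ?thesis using endo_inj_surj by (simp add: bij_betw_def)
  qed
  moreover have "bij_betw (gmap S x) Y Y" if "x \<in> Y" for x
  proof -
    have x: "x \<in> X" using that Y by auto
    then have "inj_on (gmap S x) Y" using inj_on_subset[OF _ Y] bij_betw_imp_inj_on[OF g_bij[OF x]] by blast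
    then show ?thesis using g[OF x] by (simp add: bij_betw_def)
  qed
  ultimately have "nondegenerate Y S" by (simp add: nondegenerate_def)
  moreover have "invariant_subset X S Y"
    unfolding invariant_subset_def using Y gY fY by (auto simp: S_eq)
  moreover have "involutive Y S"
    unfolding involutive_def using involutive[unfolded involutive_def] Y by blast
  moreover have "braided Y S"
    unfolding braided_def using braided[unfolded braided_def] Y by blast
  ultimately show ?thesis by (simp add: nondegenerate_invariant_subset_def)
qed

text \<open>Let \<open>Y = reach a\<close>, let \<open>Z\<close> be its complement and \<open>T z = g\<^sub>z\<^sup>-\<^sup>1 z\<close>. For \<open>z \<in> Z\<close>, the
step \<open>z \<mapsto> T z\<close>, on which \<open>reach_step\<close> is silent, does not start in \<open>Y\<close>, so \<open>g\<^sub>z\<close> preserves \<open>Z\<close>; in particular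
\<open>T z \<in> Z\<close>. As \<open>T\<close> is injective and \<open>Z\<close> is finite, \<open>T\<close> maps \<open>Z\<close> onto \<open>Z\<close> and therefore never
leads from \<open>Y\<close> to \<open>Z\<close>. So \<open>Y\<close> is closed under the steps \<open>y \<mapsto> T y\<close> as well.\<close>

lemma g_image_reach:
  assumes x: "x \<in> X"
  shows "gmap S x ` reach a = reach a"
proof -
  let ?Y = "reach a" and ?Z = "X - reach a"
  have Y: "?Y \<subseteq> X" by (auto simp: reach_def)
  have outside: "gmap S z ` ?Z = ?Z" if z: "z \<in> ?Z" for z
  proof (rule g_image_eq)
    show "gmap S z ` ?Z \<subseteq> ?Z"
    proof (rule image_subsetI)
      fix d assume d: "d \<in> ?Z"
      have "gmap S z d \<notin> ?Y"
      proof
        assume r: "gmap S z d \<in> ?Y"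
        then have "z \<noteq> gmap S z d" using z by auto
        then have "d \<in> ?Y" using reach_step[OF r] z d by simp
        then show False using d by simp
      qed
      then show "gmap S z d \<in> ?Z" using g_closed z d by simp
    qed
  qed (use z in auto)
  show ?thesis
  proof (cases "x \<in> ?Y")
    case False
    then show ?thesis using outside[of x] g_image_complement[of x ?Z] x Y by (simp add: double_diff)
  next
    case True
    obtain t where t: "t \<in> X" "gmap S x t = x" using g_surj x by metis
    define T where "T z = inv_into X (gmap S z) z" for z
    have T: "T z \<in> X \<and> gmap S z (T z) = z" if "z \<in> X" for z
      using that g_bij[OF that] unfolding T_def bij_betw_def by (metis f_inv_into_f inv_into_into)
    have "T ` ?Z \<subseteq> ?Z"
    proof
      fix s assume "s \<in> T ` ?Z"
      then obtain z where z: "z \<in> ?Z" "s = T z" by blast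
      then have "z \<in> gmap S z ` ?Z" by (simp only: outside)
      then obtain s' where s': "s' \<in> ?Z" "gmap S z s' = z" by auto
      then have "s' = s" using T[of z] z g_inj[of z s' s] by auto
      then show "s \<in> ?Z" using s'(1) by simp
    qed
    moreover have "inj_on T ?Z"
      by (rule inj_onI) (metis DiffD1 T diagonal_inj)
    ultimately have TZ: "T ` ?Z = ?Z" using finite by (metis endo_inj_surj finite_Diff)
    have "t \<in> ?Y"
    proof (rule ccontr)
      assume "t \<notin> ?Y"
      then have "t \<in> T ` ?Z" using t(1) by (simp add: TZ)
      then obtain z where "z \<in> ?Z" "t = T z" by blast
      then have "z = x" using diagonal_inj[of z x t] T t x by auto
      then show False using \<open>z \<in> ?Z\<close> True by simp
    qed
    have "?Y \<subseteq> gmap S x ` ?Y"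
    proof
      fix y assume y: "y \<in> ?Y"
      then obtain d where d: "d \<in> X" "gmap S x d = y" using g_surj x Y by (metis subset_iff)
      then have "d \<in> ?Y"
      proof (cases "y = x")
        case True
        then show ?thesis using d t \<open>t \<in> ?Y\<close> g_inj x by metis
      next
        case False
        then show ?thesis using reach_step[of x d a] d x y by auto
      qed
      then show "y \<in> gmap S x ` ?Y" using d by blast
    qed
    then show ?thesis using Y finite
      by (metis card_image_le card_seteq finite_imageI finite_subset)
  qed
qed

lemma decomposable_if_reach_proper:
  assumes "a \<in> X" "reach a \<noteq> X"
  shows "decomposable X S"
proof -
  let ?Y = "reach a" and ?Z = "X - reach a"
  have Y: "?Y \<subseteq> X" by (auto simp: reach_def)
  have "nondegenerate_invariant_subset X S ?Y"
    by (rule nondegenerate_invariant[OF Y g_image_reach])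
  moreover have "nondegenerate_invariant_subset X S ?Z"
    by (rule nondegenerate_invariant[OF Diff_subset g_image_complement[OF _ Y g_image_reach]])
  moreover have "?Y \<noteq> {}" "?Z \<noteq> {}" using reach_self assms Y by auto
  ultimately show ?thesis unfolding decomposable_def using Y
    by (intro exI[of _ ?Y] exI[of _ ?Z]) auto
qed

text \<open>The maps \<open>g\<^sub>x\<close> with \<open>x\<close> in one part preserve this part by nondegeneracy and hence also the other
part. So no word sends a letter of one part into the other.\<close>

lemma reach_proper_if_decomposable:
  assumes "decomposable X S"
  shows "\<exists>a\<in>X. reach a \<noteq> X"
proof -
  obtain Y Z where YZ: "Y \<noteq> {}" "Z \<noteq> {}" "Y \<inter> Z = {}" "X = Y \<union> Z"
    and nY: "nondegenerate Y S" and nZ: "nondegenerate Z S"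
    using assms by (auto simp: decomposable_def nondegenerate_invariant_subset_def)
  have g: "gmap S x ` Z = Z" if x: "x \<in> X" for x
  proof (cases "x \<in> Z")
    case True
    then show ?thesis using nZ by (simp add: nondegenerate_def bij_betw_def)
  next
    case False
    then have "gmap S x ` Y = Y" using nY x YZ by (auto simp: nondegenerate_def bij_betw_def)
    moreover have "X - Y = Z" using YZ by auto
    ultimately show ?thesis using g_image_complement[of x Y] x YZ by auto
  qed
  have act: "word_action S w z \<in> Z" if "w \<in> lists X" "z \<in> Z" for w z
    using that by (induction w) (use g in auto)
  obtain a b where ab: "a \<in> Y" "b \<in> Z" using YZ by blast
  have "b \<notin> reach a"
  proof
    assume "b \<in> reach a"
    then obtain w where "w \<in> lists X" "word_action S w b = a" unfolding reach_def by blast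
    then have "a \<in> Z" using act[of w b] ab(2) by simp
    then show False using ab(1) YZ(3) by blast
  qed
  then show ?thesis using ab YZ by blast
qed

end

theorem theoremB:
  fixes X :: "'a set" and S :: "'a \<times> 'a \<Rightarrow> 'a \<times> 'a"
  assumes "finite X"
    and "set_solution X S"
    and "nondegenerate X S"
    and "involutive X S"
    and "braided X S"
  shows "indecomposable X S \<longleftrightarrow> Delta_pure_garside_monoid (structure_monoid X S)"
proof -
  interpret solution X S using assms by unfold_locales
  show ?thesis
    unfolding indecomposable_def Delta_pure_garside_monoid_def
    using garside Delta_pure_iff_reach decomposable_if_reach_proper reach_proper_if_decomposable
    by blast
qed

end
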